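(* Let $n\ge 2$ and put $$\mathcal P_n=\{(1,n-1),(n-1,1)\}\cup\{2,\ldots,n-1\}^2 .$$ There exists a symmetric oscillatory $n\times n$ matrix $A$ with $(\operatorname{bw}A,\operatorname{bw}A^{-1})=(p,q)$ if and only if $(p,q)\in\mathcal P_n$. Every pair $(p,q)\in\mathcal P_n$ is realized by a symmetric integer oscillatory $n\times n$ matrix of determinant one.
   Context: All matrices are real. A matrix is totally nonnegative (TN) if all its minors are nonnegative and totally positive (TP) if all its minors are positive. A square TN matrix is oscillatory if some positive integer power of it is TP. For a square matrix $M=(m_{ij})$ put $\operatorname{bw}_-M=\max(\{0\}\cup\{i-j:m_{ij}\ne0\})$, $\operatorname{bw}_+M=\max(\{0\}\cup\{j-i:m_{ij}\ne0\})$ and $\operatorname{bw}M=\max\{\operatorname{bw}_-M,\operatorname{bw}_+M\}$ (half-bandwidths). For $n=2$ the set $\{2,\ldots,n-1\}$ is empty, so $\mathcal P_2=\{(1,1)\}$. *)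

theory Defs
  imports
    Complex_Main
    "Jordan_Normal_Form.Determinant"
    "Jordan_Normal_Form.DL_Submatrix"
begin

definition totally_nonnegative :: "real mat \<Rightarrow> bool" where
  "totally_nonnegative A \<longleftrightarrow>
     (\<forall>I J. I \<subseteq> {..<dim_row A} \<longrightarrow> J \<subseteq> {..<dim_col A} \<longrightarrow> card I = card J \<longrightarrow>
        0 \<le> det (submatrix A I J))"

text \<open>Taking \<open>I = J = {}\<close> is harmless here and above: the empty minor equals 1.\<close>

definition totally_positive :: "real mat \<Rightarrow> bool" where
  "totally_positive A \<longleftrightarrow>
     (\<forall>I J. I \<subseteq> {..<dim_row A} \<longrightarrow> J \<subseteq> {..<dim_col A} \<longrightarrow> card I = card J \<longrightarrow>
        0 < det (submatrix A I J))"

definition oscillatory :: "real mat \<Rightarrow> bool" where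
  "oscillatory A \<longleftrightarrow>
     square_mat A \<and> totally_nonnegative A \<and> (\<exists>k>0. totally_positive (A ^\<^sub>m k))"

definition symmetric_matrix :: "real mat \<Rightarrow> bool" where
  "symmetric_matrix A \<longleftrightarrow> transpose_mat A = A"

definition integer_matrix :: "real mat \<Rightarrow> bool" where
  "integer_matrix A \<longleftrightarrow> (\<forall>i<dim_row A. \<forall>j<dim_col A. A $$ (i, j) \<in> \<int>)"

definition inverse_of_matrix :: "real mat \<Rightarrow> real mat \<Rightarrow> bool" where
  "inverse_of_matrix A B \<longleftrightarrow> inverts_mat A B \<and> inverts_mat B A"

text \<open>
  The differences below are truncated subtractions of natural numbers. The pairs for which
  truncation occurs contribute 0, which belongs to the set anyway.
\<close>

definition bw_minus :: "real mat \<Rightarrow> nat" where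
  "bw_minus M = Max ({0} \<union> {i - j | i j. i < dim_row M \<and> j < dim_col M \<and> M $$ (i, j) \<noteq> 0})"

definition bw_plus :: "real mat \<Rightarrow> nat" where
  "bw_plus M = Max ({0} \<union> {j - i | i j. i < dim_row M \<and> j < dim_col M \<and> M $$ (i, j) \<noteq> 0})"

definition bw :: "real mat \<Rightarrow> nat" where
  "bw M = max (bw_minus M) (bw_plus M)"

definition bw_pairs :: "nat \<Rightarrow> (nat \<times> nat) set" where
  "bw_pairs n = {(1, n - 1), (n - 1, 1)} \<union> {2..n - 1} \<times> {2..n - 1}"

end

theory Submission
  imports Defs "HOL-Library.Sublist"
begin

text \<open>
  Necessity: if a symmetric oscillatory \<open>A\<close> commuted with the projection onto the first \<open>t + 1\<close>
  coordinates, so would all its powers, and none of them could be totally positive. Hence neither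
  \<open>A\<close> nor its inverse is block diagonal. If one of the two is tridiagonal, its
  superdiagonal therefore has no zero, and then the corner entry of its inverse is nonzero.

  Sufficiency: for a word \<open>w\<close> in the letters \<open>0, \<dots>, n - 2\<close> let \<open>L\<close> be the product of the elementary
  bidiagonal matrices \<open>I + e\<^bsub>x+1\<^esub> e\<^bsub>x\<^esub>\<^sup>T\<close> over the letters \<open>x\<close> of \<open>w\<close>, and \<open>A = L L\<^sup>T\<close>. Up to signs, the
  entries of \<open>L\<close> and its inverse count subsequences of \<open>w\<close> that are descending respectively ascending
  runs of consecutive letters, and nothing cancels in \<open>L L\<^sup>T\<close> and its inverse, so both bandwidths are
  maximal run lengths in \<open>w\<close>. Adding a row to an adjacent one changes each minor by another minor
  of the same matrix, which yields total nonnegativity and, when every letter occurs, positivity of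
  all minors of a high power.
\<close>

section \<open>Products of elementary bidiagonal matrices\<close>

text \<open>\<open>addrow c i j\<close> adds \<open>c\<close> times row \<open>j\<close> to row
  \<open>i\<close>. With \<open>foldr\<close> the first letter acts last, so a word lists the matrix
  factors from left to right.\<close>

definition shears :: "real \<Rightarrow> (nat \<times> nat) list \<Rightarrow> real mat \<Rightarrow> real mat" where
  "shears c ws M = foldr (\<lambda>(i, j). addrow c i j) ws M"

definition adjacent_word :: "nat \<Rightarrow> (nat \<times> nat) list \<Rightarrow> bool" where
  "adjacent_word n ws \<longleftrightarrow> (\<forall>(i, j) \<in> set ws. i < n \<and> j < n \<and> (i = Suc j \<or> j = Suc i))"

abbreviation shear_mat :: "nat \<Rightarrow> real \<Rightarrow> (nat \<times> nat) list \<Rightarrow> real mat" where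
  "shear_mat n c ws \<equiv> shears c ws (1\<^sub>m n)"

lemma shears_simps [simp]:
  "shears c [] M = M"
  "shears c ((i, j) # ws) M = addrow c i j (shears c ws M)"
  "shears c (us @ vs) M = shears c us (shears c vs M)"
  by (simp_all add: shears_def)

lemma adjacent_word_simps [simp]:
  "adjacent_word n []"
  "adjacent_word n ((i, j) # ws) \<longleftrightarrow> i < n \<and> j < n \<and> (i = Suc j \<or> j = Suc i) \<and> adjacent_word n ws"
  "adjacent_word n (us @ vs) \<longleftrightarrow> adjacent_word n us \<and> adjacent_word n vs"
  "adjacent_word n (rev ws) \<longleftrightarrow> adjacent_word n ws"
  "adjacent_word n (map prod.swap ws) \<longleftrightarrow> adjacent_word n ws"
  by (auto simp add: adjacent_word_def case_prod_unfold ball_Un)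

lemma dim_shears [simp]:
  "dim_row (shears c ws M) = dim_row M" "dim_col (shears c ws M) = dim_col M"
  by (induction ws) (simp_all add: shears_def case_prod_beta)

lemma shears_carrier [simp]: "shears c ws M \<in> carrier_mat n m \<longleftrightarrow> M \<in> carrier_mat n m"
  unfolding carrier_mat_def by simp

lemma shears_eq_mult:
  assumes "M \<in> carrier_mat n m" "adjacent_word n ws"
  shows "shears c ws M = shear_mat n c ws * M"
  using assms(2)
proof (induction ws)
  case Nil
  then show ?case using assms(1) by simp
next
  case (Cons x ws)
  obtain i j where x: "x = (i, j)" by force
  have "shears c (x # ws) M = addrow_mat n c i j * (shear_mat n c ws * M)"
    using Cons.prems Cons.IH[symmetric] assms(1) x addrow_mat[of "shears c ws M" n m j c i]
    by simp
  also have "\<dots> = (addrow_mat n c i j * shear_mat n c ws) * M"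
    using assms(1) by (intro assoc_mult_mat[symmetric, where n\<^sub>1 = n and n\<^sub>2 = n and n\<^sub>3 = n and n\<^sub>4 = m]) auto
  also have "addrow_mat n c i j * shear_mat n c ws = shear_mat n c (x # ws)"
    using Cons.prems x addrow_mat[of "shear_mat n c ws" n n j c i] by simp
  finally show ?case .
qed

lemma shear_mat_append:
  assumes "adjacent_word n us"
  shows "shear_mat n c (us @ vs) = shear_mat n c us * shear_mat n c vs"
  unfolding shears_simps by (rule shears_eq_mult[where m = n]) (use assms in simp_all)

lemma transpose_shear_mat:
  assumes "adjacent_word n ws"
  shows "transpose_mat (shear_mat n c ws) = shear_mat n c (rev (map prod.swap ws))"
  using assms
proof (induction ws)
  case Nil
  then show ?case by simp
next
  case (Cons x ws)
  obtain i j where x: "x = (i, j)" by force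
  have ij: "i < n" "j < n" "i \<noteq> j" using Cons.prems x by auto
  have e: "shear_mat n c [(j, i)] = addrow_mat n c j i"
    using ij addrow_mat[of "1\<^sub>m n" n n i c j] by simp
  have t: "transpose_mat (addrow_mat n c i j) = addrow_mat n c j i"
    by (rule eq_matI) (auto simp: addrow_mat_def)
  have "shear_mat n c (x # ws) = addrow_mat n c i j * shear_mat n c ws"
    using ij x addrow_mat[of "shear_mat n c ws" n n j c i] by simp
  then have "transpose_mat (shear_mat n c (x # ws)) =
      transpose_mat (shear_mat n c ws) * addrow_mat n c j i"
    using t transpose_mult[of "addrow_mat n c i j" n n "shear_mat n c ws" n] by simp
  also have "\<dots> = shear_mat n c (rev (map prod.swap ws) @ [(j, i)])"
    using Cons x e by (subst shear_mat_append) auto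
  finally show ?case using x by simp
qed

text \<open>For distinct rows, the coefficient \<open>- c\<close> undoes a row addition, and the
  most recent addition is undone first.\<close>

lemma shear_mat_inverse:
  assumes "adjacent_word n ws"
  shows "shear_mat n (- c) (rev ws) * shear_mat n c ws = 1\<^sub>m n"
proof -
  have *: "shears (- c) (rev ws) (shears c ws M) = M"
    if "M \<in> carrier_mat n n" "adjacent_word n ws" for M
    using that
  proof (induction ws)
    case Nil
    then show ?case by simp
  next
    case (Cons x ws)
    obtain i j where x: "x = (i, j)" by force
    have "addrow (- c) i j (addrow c i j (shears c ws M)) = shears c ws M"
      using Cons.prems x by (intro eq_matI) auto
    then show ?case using Cons x by simp
  qed
  then show ?thesis
    using assms by (subst shears_eq_mult[symmetric, where m = n]) simp_all
qed

text \<open>Adjacent indices have opposite parity, so passing from \<open>c\<close> to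
  \<open>- c\<close> conjugates every factor with the diagonal matrix of alternating signs.\<close>

lemma shear_mat_uminus:
  assumes "adjacent_word n ws" "i < n" "j < n"
  shows "shear_mat n (- c) ws $$ (i, j) = (-1) ^ (i + j) * shear_mat n c ws $$ (i, j)"
  using assms
proof (induction ws arbitrary: i)
  case Nil
  then show ?case by (cases "i = j") (simp_all flip: mult_2)
next
  case (Cons x ws)
  obtain k l where x: "x = (k, l)" by force
  have kl: "k < n" "l < n" "k = Suc l \<or> l = Suc k" and ws: "adjacent_word n ws"
    using Cons.prems x by auto
  have sgn: "(-1 :: real) ^ (k + j) = - ((-1) ^ (l + j))"
    using kl(3) by auto
  show ?case
  proof (cases "i = k")
    case True
    then show ?thesis
      using Cons.prems kl x Cons.IH[OF ws kl(1)] Cons.IH[OF ws kl(2)] sgn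
      by (simp add: distrib_left)
  next
    case False
    then show ?thesis using Cons.prems x Cons.IH[OF ws] by simp
  qed
qed

lemma det_shear_mat:
  assumes "adjacent_word n ws"
  shows "det (shear_mat n c ws) = 1"
  using assms
proof (induction ws)
  case (Cons x ws)
  then show ?case by (cases x) (auto simp: det_addrow[where n = n])
qed simp

lemma integer_matrix_shear_mat:
  assumes "adjacent_word n ws"
  shows "integer_matrix (shear_mat n 1 ws)"
  using assms
proof (induction ws)
  case (Cons x ws)
  obtain k l where x: "x = (k, l)" by force
  show ?case
    unfolding integer_matrix_def
  proof (intro allI impI)
    fix i j assume "i < dim_row (shear_mat n 1 (x # ws))" "j < dim_col (shear_mat n 1 (x # ws))"
    then have ij: "i < n" "j < n" by simp_all
    have kl: "k < n" "l < n" and IH: "\<And>i. i < n \<Longrightarrow> shear_mat n 1 ws $$ (i, j) \<in> \<int>"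
      using Cons ij x by (auto simp: integer_matrix_def)
    show "shear_mat n 1 (x # ws) $$ (i, j) \<in> \<int>"
      using ij kl x IH[OF ij(1)] IH[OF kl(2)] by simp
  qed
qed (simp add: integer_matrix_def)

section \<open>Minors under adjacent row additions\<close>

text \<open>Index functions instead of index sets make it possible to replace a single index, even
  by one that is already selected.\<close>

definition minor :: "real mat \<Rightarrow> nat \<Rightarrow> (nat \<Rightarrow> nat) \<Rightarrow> (nat \<Rightarrow> nat) \<Rightarrow> real" where
  "minor M k f g = det (mat k k (\<lambda>(a, b). M $$ (f a, g b)))"

lemma minor_cong:
  assumes "\<And>a b. a < k \<Longrightarrow> b < k \<Longrightarrow> M $$ (f a, g b) = M' $$ (f' a, g' b)"
  shows "minor M k f g = minor M' k f' g'"
  unfolding minor_def by (rule arg_cong[where f = det]) (auto intro!: eq_matI simp: assms)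

lemma minor_expand:
  "minor M k f g = (\<Sum>p | p permutes {0..<k}. signof p * (\<Prod>b = 0..<k. M $$ (f b, g (p b))))"
  unfolding minor_def by (subst det_def'[of _ k])
    (auto intro!: sum.cong prod.cong dest: permutes_in_image)

lemma minor_eq_0:
  assumes "a < k" "b < k" "a \<noteq> b" "f a = f b"
  shows "minor M k f g = 0"
  unfolding minor_def
  by (rule det_identical_rows[of _ k a b]) (use assms in \<open>auto intro!: eq_vecI\<close>)

text \<open>The determinant is linear in row \<open>a\<close>, the only selected row that the
  addition changes.\<close>

lemma minor_addrow:
  assumes "M \<in> carrier_mat n n" "a < k" "f a = i"
    and "\<And>b. b < k \<Longrightarrow> b \<noteq> a \<Longrightarrow> f b \<noteq> i"
    and "\<And>b. b < k \<Longrightarrow> f b < n" "\<And>b. b < k \<Longrightarrow> g b < n"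
  shows "minor (addrow 1 i j M) k f g = minor M k f g + minor M k (f(a := j)) g"
proof -
  let ?P = "{p. p permutes {0..<k}}"
  have *: "minor N k h g = (\<Sum>p\<in>?P. signof p * (N $$ (h a, g (p a)) *
      (\<Prod>b\<in>{0..<k} - {a}. N $$ (h b, g (p b)))))" for N h
  proof -
    show ?thesis using assms(2) by (simp add: minor_expand prod.remove[of _ a])
  qed
  show ?thesis
    unfolding * sum.distrib[symmetric]
  proof (rule sum.cong[OF refl], goal_cases)
    case (1 p)
    then have p: "b < k \<Longrightarrow> g (p b) < n" for b
      using permutes_in_image[of p "{0..<k}" b] assms(6) by auto
    have "(\<Prod>b\<in>{0..<k} - {a}. addrow 1 i j M $$ (f b, g (p b))) =
          (\<Prod>b\<in>{0..<k} - {a}. M $$ (f b, g (p b)))"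
    proof (rule prod.cong[OF refl])
      fix b assume "b \<in> {0..<k} - {a}"
      then have "b < k" "i \<noteq> f b" using assms(4)[of b] by auto
      then show "addrow 1 i j M $$ (f b, g (p b)) = M $$ (f b, g (p b))"
        using assms(1) assms(5)[of b] p[of b] by simp
    qed
    moreover have "(\<Prod>b\<in>{0..<k} - {a}. M $$ ((f(a := j)) b, g (p b))) =
          (\<Prod>b\<in>{0..<k} - {a}. M $$ (f b, g (p b)))"
      by (intro prod.cong) auto
    moreover have "addrow 1 i j M $$ (f a, g (p a)) = M $$ (j, g (p a)) + M $$ (f a, g (p a))"
      using assms(1-3) assms(5)[of a] p[of a] by simp
    ultimately show ?case by (simp add: algebra_simps)
  qed
qed

definition minors_nonneg :: "nat \<Rightarrow> real mat \<Rightarrow> bool" where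
  "minors_nonneg n M \<longleftrightarrow> (\<forall>k f g. mono_on {..<k} f \<longrightarrow> mono_on {..<k} g \<longrightarrow>
     f ` {..<k} \<subseteq> {..<n} \<longrightarrow> g ` {..<k} \<subseteq> {..<n} \<longrightarrow> 0 \<le> minor M k f g)"

lemma minors_nonnegD:
  assumes "minors_nonneg n M" "mono_on {..<k} f" "mono_on {..<k} g"
    and "\<And>b. b < k \<Longrightarrow> f b < n" "\<And>b. b < k \<Longrightarrow> g b < n"
  shows "0 \<le> minor M k f g"
  using assms unfolding minors_nonneg_def by blast

text \<open>Replacing an index by an adjacent one keeps an increasing index tuple weakly increasing, so
  both terms of the row expansion are minors of the same kind.\<close>

lemma mono_on_update_adjacent:
  assumes "mono_on {..<k} f" "a < k" "inj_on f {..<k}" "f a = Suc j \<or> j = Suc (f a)"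
  shows "mono_on {..<k} (f(a := j))"
proof (rule mono_onI)
  fix r s assume rs: "r \<in> {..<k}" "s \<in> {..<k}" "r \<le> s"
  have le: "f r \<le> f s" using assms(1) rs by (auto dest: mono_onD)
  have ne: "f r \<noteq> f s" if "r \<noteq> s" using assms(3) rs that by (auto dest: inj_onD)
  show "(f(a := j)) r \<le> (f(a := j)) s"
    using le ne assms(4) by auto
qed

text \<open>A repeated row index makes both minors vanish. If row \<open>i\<close> is not selected,
  nothing changes; otherwise the extra term is a nonnegative minor.\<close>

lemma minor_addrow_ge:
  assumes M: "M \<in> carrier_mat n n" "minors_nonneg n M"
    and ij: "i = Suc j \<or> j = Suc i" "j < n"
    and f: "mono_on {..<k} f" "\<And>b. b < k \<Longrightarrow> f b < n"
    and g: "mono_on {..<k} g" "\<And>b. b < k \<Longrightarrow> g b < n"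
  shows "minor M k f g \<le> minor (addrow 1 i j M) k f g"
proof (cases "inj_on f {..<k}")
  case False
  then obtain a b where "a < k" "b < k" "a \<noteq> b" "f a = f b"
    by (auto simp: inj_on_def)
  then show ?thesis by (simp add: minor_eq_0)
next
  case inj: True
  show ?thesis
  proof (cases "\<exists>a<k. f a = i")
    case True
    then obtain a where a: "a < k" "f a = i" by blast
    have "minor (addrow 1 i j M) k f g = minor M k f g + minor M k (f(a := j)) g"
      using a inj M f g by (intro minor_addrow) (auto dest: inj_onD)
    moreover have "0 \<le> minor M k (f(a := j)) g"
      using M(2) a inj f g ij by (intro minors_nonnegD[of n] mono_on_update_adjacent) auto
    ultimately show ?thesis by simp
  next
    case False
    have "minor (addrow 1 i j M) k f g = minor M k f g"
      using False M(1) f(2) g(2) by (intro minor_cong) auto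
    then show ?thesis by simp
  qed
qed

lemma minors_nonneg_shears:
  assumes "M \<in> carrier_mat n n" "minors_nonneg n M" "adjacent_word n ws"
  shows "minors_nonneg n (shears 1 ws M)"
  using assms(3)
proof (induction ws)
  case Nil
  then show ?case using assms by simp
next
  case (Cons x ws)
  obtain i j where x: "x = (i, j)" by force
  have nn: "minors_nonneg n (shears 1 ws M)" using Cons x by simp
  show ?case unfolding minors_nonneg_def
  proof (intro allI impI)
    fix k :: nat and f g :: "nat \<Rightarrow> nat"
    assume fg: "mono_on {..<k} f" "mono_on {..<k} g" "f ` {..<k} \<subseteq> {..<n}" "g ` {..<k} \<subseteq> {..<n}"
    have "0 \<le> minor (shears 1 ws M) k f g"
      using nn fg by (intro minors_nonnegD) auto
    also have "\<dots> \<le> minor (addrow 1 i j (shears 1 ws M)) k f g"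
      using nn fg Cons.prems x assms(1) by (intro minor_addrow_ge[of _ n]) auto
    finally show "0 \<le> minor (shears 1 (x # ws) M) k f g" using x by simp
  qed
qed

lemma minor_shears_ge:
  assumes "M \<in> carrier_mat n n" "minors_nonneg n M" "adjacent_word n ws"
    and "mono_on {..<k} f" "\<And>b. b < k \<Longrightarrow> f b < n"
    and "mono_on {..<k} g" "\<And>b. b < k \<Longrightarrow> g b < n"
  shows "minor M k f g \<le> minor (shears 1 ws M) k f g"
  using assms(3)
proof (induction ws)
  case (Cons x ws)
  obtain i j where x: "x = (i, j)" by force
  have "minor M k f g \<le> minor (shears 1 ws M) k f g"
    using Cons x by simp
  also have "\<dots> \<le> minor (addrow 1 i j (shears 1 ws M)) k f g"
    using Cons.prems x assms minors_nonneg_shears[OF assms(1,2), of ws]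
    by (intro minor_addrow_ge[of _ n]) auto
  finally show ?case using x by simp
qed simp

text \<open>At one occurrence of \<open>(i, j)\<close> the row expansion contributes the minor with
  \<open>i\<close> replaced by \<open>j\<close>; all other letters can only increase minors.\<close>

lemma minor_shears_move:
  assumes M: "M \<in> carrier_mat n n" "minors_nonneg n M"
    and ws: "adjacent_word n ws" "(i, j) \<in> set ws"
    and f: "mono_on {..<k} f" "inj_on f {..<k}" "\<And>b. b < k \<Longrightarrow> f b < n"
    and g: "mono_on {..<k} g" "\<And>b. b < k \<Longrightarrow> g b < n"
    and a: "a < k" "f a = i"
  shows "minor M k (f(a := j)) g \<le> minor (shears 1 ws M) k f g"
proof -
  obtain us vs where split: "ws = us @ (i, j) # vs" using ws(2) by (meson split_list)
  then have adj: "i < n" "j < n" "i = Suc j \<or> j = Suc i" "adjacent_word n us" "adjacent_word n vs"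
    using ws(1) by auto
  let ?V = "shears 1 vs M"
  have V: "?V \<in> carrier_mat n n" "minors_nonneg n ?V"
    using M adj minors_nonneg_shears by auto
  have W: "minors_nonneg n (addrow 1 i j ?V)"
    using minors_nonneg_shears[OF V, of "[(i, j)]"] adj by simp
  have "minor M k (f(a := j)) g \<le> minor ?V k (f(a := j)) g"
    using M adj f g a by (intro minor_shears_ge[of _ n] mono_on_update_adjacent) auto
  also have "\<dots> \<le> minor ?V k f g + minor ?V k (f(a := j)) g"
    using V f g by (simp add: minors_nonnegD)
  also have "\<dots> = minor (addrow 1 i j ?V) k f g"
    using V a f g by (intro minor_addrow[symmetric]) (auto dest: inj_onD)
  also have "\<dots> \<le> minor (shears 1 us (addrow 1 i j ?V)) k f g"
    using V W adj f g by (intro minor_shears_ge[of _ n]) auto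
  finally show ?thesis using split by simp
qed

lemma minor_transpose:
  assumes "M \<in> carrier_mat n n" "\<And>b. b < k \<Longrightarrow> f b < n" "\<And>b. b < k \<Longrightarrow> g b < n"
  shows "minor (transpose_mat M) k f g = minor M k g f"
proof -
  have "mat k k (\<lambda>(a, b). transpose_mat M $$ (f a, g b)) =
      transpose_mat (mat k k (\<lambda>(a, b). M $$ (g a, f b)))"
    using assms by (intro eq_matI) auto
  then show ?thesis unfolding minor_def by (simp add: det_transpose[of _ k])
qed

lemma minor_zero_row:
  assumes "a < k" "\<And>b. b < k \<Longrightarrow> M $$ (f a, g b) = 0"
  shows "minor M k f g = 0"
proof -
  have *: "(\<Prod>b = 0..<k. M $$ (f b, g (p b))) = 0" if "p permutes {0..<k}" for p
    using assms permutes_in_image[OF that, of a] by (intro prod_zero) (auto intro!: bexI[of _ a])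
  show ?thesis
    unfolding minor_expand by (intro sum.neutral ballI) (simp only: mem_Collect_eq * mult_zero_right)
qed

lemma minor_one_diag:
  assumes "inj_on f {..<k}" "\<And>b. b < k \<Longrightarrow> f b < n"
  shows "minor (1\<^sub>m n) k f f = 1"
proof -
  have "mat k k (\<lambda>(a, b). 1\<^sub>m n $$ (f a, f b)) = (1\<^sub>m k :: real mat)"
    using assms by (intro eq_matI) (auto dest: inj_onD)
  then show ?thesis unfolding minor_def by simp
qed

lemma mono_inj_image_unique:
  fixes f g :: "nat \<Rightarrow> nat"
  assumes "mono_on {..<k} f" "inj_on f {..<k}" "mono_on {..<k} g" "inj_on g {..<k}"
    and "f ` {..<k} = g ` {..<k}" "a < k"
  shows "f a = g a"
proof -
  have *: "sorted (map h [0..<k])" if "mono_on {..<k} h" for h :: "nat \<Rightarrow> nat"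
    using that by (auto simp: sorted_iff_nth_mono intro: mono_onD)
  have d: "distinct (map h [0..<k])" if "inj_on h {..<k}" for h :: "nat \<Rightarrow> nat"
    using that by (simp add: distinct_map lessThan_atLeast0)
  have "map f [0..<k] = map g [0..<k]"
    by (rule sorted_distinct_set_unique) (use assms * d in \<open>auto simp: lessThan_atLeast0\<close>)
  then show ?thesis using assms(6) by simp
qed

lemma minors_nonneg_one: "minors_nonneg n (1\<^sub>m n)"
  unfolding minors_nonneg_def
proof (intro allI impI)
  fix k and f g :: "nat \<Rightarrow> nat"
  assume fg: "mono_on {..<k} f" "mono_on {..<k} g" "f ` {..<k} \<subseteq> {..<n}" "g ` {..<k} \<subseteq> {..<n}"
  then have lt: "\<And>b. b < k \<Longrightarrow> f b < n" "\<And>b. b < k \<Longrightarrow> g b < n" by auto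
  have f0: "minor M k h h' = 0" if "\<not> inj_on h {..<k}" for M h h'
    using that minor_eq_0 unfolding inj_on_def by (metis lessThan_iff)
  have g0: "minor (1\<^sub>m n) k f g = 0" if "\<not> inj_on g {..<k}"
    using minor_transpose[of "1\<^sub>m n" n k g f] f0[OF that, of "1\<^sub>m n" f] lt by simp
  consider "\<not> inj_on f {..<k} \<or> \<not> inj_on g {..<k}"
    | "inj_on f {..<k}" "inj_on g {..<k}" "f ` {..<k} = g ` {..<k}"
    | "inj_on f {..<k}" "inj_on g {..<k}" "f ` {..<k} \<noteq> g ` {..<k}" by blast
  then show "0 \<le> minor (1\<^sub>m n) k f g"
  proof cases
    case 1
    then show ?thesis using f0 g0 by auto
  next
    case 2
    have "minor (1\<^sub>m n) k f g = minor (1\<^sub>m n) k f f"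
      using mono_inj_image_unique[OF fg(1) 2(1) fg(2) 2(2,3)] by (intro minor_cong) auto
    then show ?thesis using minor_one_diag[OF 2(1) lt(1)] by simp
  next
    case 3
    \<comment> \<open>Both images have \<open>k\<close> elements, so being distinct they are not
      nested, and some selected row of the identity is zero in all selected columns.\<close>
    have "\<not> f ` {..<k} \<subseteq> g ` {..<k}"
      using 3 card_subset_eq[of "g ` {..<k}" "f ` {..<k}"] by (auto simp: card_image)
    then obtain a where a: "a < k" "f a \<notin> g ` {..<k}" by blast
    then have "minor (1\<^sub>m n) k f g = 0"
      using lt by (intro minor_zero_row[of a]) auto
    then show ?thesis by simp
  qed
qed

section \<open>From index tuples to submatrices\<close>

lemma det_submatrix_eq_minor:
  assumes "A \<in> carrier_mat n n" "I \<subseteq> {..<n}" "J \<subseteq> {..<n}" "card I = card J"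
  shows "det (submatrix A I J) = minor A (card I) (pick I) (pick J)"
proof -
  have "{i. i < dim_row A \<and> i \<in> I} = I" "{j. j < dim_col A \<and> j \<in> J} = J"
    using assms by auto
  then show ?thesis using assms(4) unfolding submatrix_def minor_def by simp
qed

lemma pick_mono_on:
  shows "mono_on {..<card I} (pick I)" "inj_on (pick I) {..<card I}"
proof -
  have "strict_mono_on {..<card I} (pick I)"
    by (auto intro!: strict_mono_onI pick_mono_le)
  then show "mono_on {..<card I} (pick I)" "inj_on (pick I) {..<card I}"
    by (auto intro: strict_mono_on_imp_mono_on strict_mono_on_imp_inj_on)
qed

lemma pick_less:
  assumes "I \<subseteq> {..<n}" "b < card I"
  shows "pick I b < n"
  using pick_in_set_le[OF assms(2)] assms(1) by auto

lemma totally_nonnegative_if_minors_nonneg: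
  assumes "A \<in> carrier_mat n n" "minors_nonneg n A"
  shows "totally_nonnegative A"
  unfolding totally_nonnegative_def
proof (intro allI impI)
  fix I J assume IJ: "I \<subseteq> {..<dim_row A}" "J \<subseteq> {..<dim_col A}" "card I = card J"
  then have IJ': "I \<subseteq> {..<n}" "J \<subseteq> {..<n}" using assms(1) by auto
  have "0 \<le> minor A (card I) (pick I) (pick J)"
    using pick_mono_on[of I] pick_mono_on[of J] pick_less[OF IJ'(1)] pick_less[OF IJ'(2)] IJ(3)
    by (intro minors_nonnegD[OF assms(2)]) auto
  then show "0 \<le> det (submatrix A I J)"
    using det_submatrix_eq_minor[OF assms(1) IJ' IJ(3)] by simp
qed

section \<open>Powers of symmetric products are eventually totally positive\<close>

lemma pow_mat_Suc_left:
  assumes "A \<in> carrier_mat n n"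
  shows "A ^\<^sub>m Suc k = A * A ^\<^sub>m k"
proof (induction k)
  case 0
  then show ?case using assms by simp
next
  case (Suc k)
  have "A ^\<^sub>m Suc (Suc k) = (A * A ^\<^sub>m k) * A" using Suc by simp
  also have "\<dots> = A * (A ^\<^sub>m k * A)"
    using assms by (intro assoc_mult_mat[of _ n n _ n _ n]) auto
  finally show ?case by simp
qed

lemma transpose_pow_mat:
  fixes A :: "real mat"
  assumes "A \<in> carrier_mat n n" "transpose_mat A = A"
  shows "transpose_mat (A ^\<^sub>m k) = A ^\<^sub>m k"
proof (induction k)
  case 0
  then show ?case by simp
next
  case (Suc k)
  have "transpose_mat (A ^\<^sub>m Suc k) = A * A ^\<^sub>m k"
    using assms Suc transpose_mult[of "A ^\<^sub>m k" n n A n] by simp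
  then show ?case using pow_mat_Suc_left[OF assms(1)] by simp
qed

context
  fixes n :: nat and ws :: "(nat \<times> nat) list"
  assumes ws: "adjacent_word n ws"
begin

lemma shear_mat_pow_Suc: "shear_mat n 1 ws ^\<^sub>m Suc N = shears 1 ws (shear_mat n 1 ws ^\<^sub>m N)"
  using pow_mat_Suc_left[of "shear_mat n 1 ws" n N]
    shears_eq_mult[OF _ ws, of "shear_mat n 1 ws ^\<^sub>m N" n 1] by simp

lemma minors_nonneg_shear_mat_pow: "minors_nonneg n (shear_mat n 1 ws ^\<^sub>m N)"
proof (induction N)
  case 0
  then show ?case by (simp add: minors_nonneg_one)
next
  case (Suc N)
  then show ?case unfolding shear_mat_pow_Suc using ws by (intro minors_nonneg_shears) auto
qed

lemma minor_shear_mat_pow_mono: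
  assumes "mono_on {..<k} f" "\<And>b. b < k \<Longrightarrow> f b < n"
    and "mono_on {..<k} g" "\<And>b. b < k \<Longrightarrow> g b < n" and "N \<le> N'"
  shows "minor (shear_mat n 1 ws ^\<^sub>m N) k f g \<le> minor (shear_mat n 1 ws ^\<^sub>m N') k f g"
proof (rule lift_Suc_mono_le[OF _ assms(5)])
  fix N
  show "minor (shear_mat n 1 ws ^\<^sub>m N) k f g \<le> minor (shear_mat n 1 ws ^\<^sub>m Suc N) k f g"
    unfolding shear_mat_pow_Suc
    using ws assms(1-4) minors_nonneg_shear_mat_pow by (intro minor_shears_ge) auto
qed

text \<open>Every increasing index tuple is reached from \<open>(0, \<dots>, k - 1)\<close> by raising one entry by one at a
  time, and each such move is available in every further factor of the power.\<close>

lemma minor_shear_mat_pow_climb: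
  assumes down: "\<And>i. Suc i < n \<Longrightarrow> (Suc i, i) \<in> set ws"
    and g: "mono_on {..<k} g" "\<And>b. b < k \<Longrightarrow> g b < n"
    and base: "0 < minor (shear_mat n 1 ws ^\<^sub>m N) k (\<lambda>a. a) g"
    and f: "mono_on {..<k} f" "inj_on f {..<k}" "\<And>b. b < k \<Longrightarrow> f b < n"
  shows "\<exists>N. 0 < minor (shear_mat n 1 ws ^\<^sub>m N) k f g"
  using f
proof (induction "\<Sum>a<k. f a" arbitrary: f rule: less_induct)
  case less
  show ?case
  proof (cases "\<forall>a<k. f a = a")
    case True
    then have "minor (shear_mat n 1 ws ^\<^sub>m N) k f g = minor (shear_mat n 1 ws ^\<^sub>m N) k (\<lambda>a. a) g"
      by (intro minor_cong) auto
    then show ?thesis using base by (intro exI[of _ N]) simp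
  next
    case False
    \<comment> \<open>\<open>a\<close> is the first index out of place. A value
      \<open>f a < a\<close> would be a fixed point of \<open>f\<close>, against
      injectivity.\<close>
    then obtain a where a: "a < k" "f a \<noteq> a" and min: "\<And>b. b < a \<Longrightarrow> f b = b"
      using exists_least_iff[of "\<lambda>a. a < k \<and> f a \<noteq> a"] by (metis less_trans)
    have "\<not> f a < a"
      using min[of "f a"] a inj_onD[OF less.prems(2), of "f a" a] by auto
    then obtain j where j: "f a = Suc j" "a \<le> j"
      using a(2) by (metis Suc_le_eq Suc_le_D le_neq_implies_less not_less Suc_le_mono)
    let ?f = "f(a := j)"
    \<comment> \<open>Indices before \<open>a\<close> carry values below \<open>a\<close>, later
      ones values at least \<open>f a\<close>, so the value \<open>j\<close> is free.\<close>
    have ne: "f b \<noteq> j" if "b < k" "b \<noteq> a" for b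
    proof (cases "b < a")
      case True
      then show ?thesis using min[of b] j by simp
    next
      case False
      then have "f a \<le> f b" using that a less.prems(1) by (auto intro: mono_onD)
      then show ?thesis using j by simp
    qed
    have "inj_on ?f {..<k}"
      using less.prems(2) ne by (auto simp: inj_on_def)
    moreover have "mono_on {..<k} ?f"
      using less.prems a j by (intro mono_on_update_adjacent) auto
    moreover have "(\<Sum>a<k. ?f a) < (\<Sum>a<k. f a)"
      using a j by (intro sum_strict_mono_ex1) auto
    moreover have "?f b < n" if "b < k" for b
      using less.prems(3)[OF that] j by auto
    ultimately obtain N where N: "0 < minor (shear_mat n 1 ws ^\<^sub>m N) k ?f g"
      using less.hyps by blast
    \<comment> \<open>The letter \<open>(Suc j, j)\<close> carries positivity from \<open>?f\<close>
      back to \<open>f\<close> at the cost of one more factor.\<close>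
    have "minor (shear_mat n 1 ws ^\<^sub>m N) k ?f g \<le> minor (shear_mat n 1 ws ^\<^sub>m Suc N) k f g"
      unfolding shear_mat_pow_Suc
      using minors_nonneg_shear_mat_pow ws down[of j] less.prems(3)[OF a(1)] less.prems g a j
      by (intro minor_shears_move) auto
    then show ?thesis using N by (intro exI[of _ "Suc N"]) simp
  qed
qed

text \<open>Start from a leading principal minor of the identity, climb with the rows to
  \<open>g\<close>, transpose by symmetry, and climb with the rows to \<open>f\<close>.\<close>

lemma minor_shear_mat_pow_pos:
  assumes down: "\<And>i. Suc i < n \<Longrightarrow> (Suc i, i) \<in> set ws"
    and sym: "transpose_mat (shear_mat n 1 ws) = shear_mat n 1 ws"
    and f: "mono_on {..<k} f" "inj_on f {..<k}" "\<And>b. b < k \<Longrightarrow> f b < n"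
    and g: "mono_on {..<k} g" "inj_on g {..<k}" "\<And>b. b < k \<Longrightarrow> g b < n"
  shows "\<exists>N. 0 < minor (shear_mat n 1 ws ^\<^sub>m N) k f g"
proof -
  have "card (f ` {..<k}) \<le> card {..<n}"
    using f(3) by (intro card_mono) auto
  then have "k \<le> n" using f(2) by (simp add: card_image)
  then have init: "mono_on {..<k} (\<lambda>a. a)" "\<And>b. b < k \<Longrightarrow> b < n" by (auto intro: mono_onI)
  have "0 < minor (shear_mat n 1 ws ^\<^sub>m 0) k (\<lambda>a. a) (\<lambda>a. a)"
    using init by (simp add: minor_one_diag)
  from minor_shear_mat_pow_climb[OF down init this g]
  obtain N where "0 < minor (shear_mat n 1 ws ^\<^sub>m N) k g (\<lambda>a. a)" by blast
  then have "0 < minor (shear_mat n 1 ws ^\<^sub>m N) k (\<lambda>a. a) g"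
    using minor_transpose[of "shear_mat n 1 ws ^\<^sub>m N" n k g "\<lambda>a. a"] g(3) init(2)
      transpose_pow_mat[OF _ sym, of n N] by simp
  from minor_shear_mat_pow_climb[OF down g(1,3) this f] show ?thesis .
qed

text \<open>Each minor is positive for some power and does not decrease afterwards; as there are
  finitely many minors, one exponent serves them all.\<close>

lemma oscillatory_shear_mat:
  assumes down: "\<And>i. Suc i < n \<Longrightarrow> (Suc i, i) \<in> set ws"
    and sym: "transpose_mat (shear_mat n 1 ws) = shear_mat n 1 ws"
  shows "oscillatory (shear_mat n 1 ws)"
proof -
  let ?X = "shear_mat n 1 ws"
  let ?S = "{(I, J). I \<subseteq> {..<n} \<and> J \<subseteq> {..<n} \<and> card I = card J}"
  have ev: "\<forall>\<^sub>F N in sequentially. 0 < det (submatrix (?X ^\<^sub>m N) I J)" if IJ: "(I, J) \<in> ?S" for I J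
  proof -
    have lt: "\<And>b. b < card I \<Longrightarrow> pick I b < n" "\<And>b. b < card I \<Longrightarrow> pick J b < n"
      using IJ pick_less by auto
    note mono = pick_mono_on[of I] pick_mono_on[of J]
    have "\<exists>N. 0 < minor (?X ^\<^sub>m N) (card I) (pick I) (pick J)"
      using IJ mono lt by (intro minor_shear_mat_pow_pos[OF down sym]) auto
    then obtain N where N: "0 < minor (?X ^\<^sub>m N) (card I) (pick I) (pick J)" by blast
    have "0 < minor (?X ^\<^sub>m N') (card I) (pick I) (pick J)" if "N \<le> N'" for N'
      using IJ mono lt that by (intro less_le_trans[OF N minor_shear_mat_pow_mono]) auto
    moreover have "det (submatrix (?X ^\<^sub>m N') I J) = minor (?X ^\<^sub>m N') (card I) (pick I) (pick J)" for N'
      using IJ by (intro det_submatrix_eq_minor[where n = n]) auto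
    ultimately show ?thesis by (auto simp: eventually_sequentially)
  qed
  have "finite ?S"
    by (rule finite_subset[of _ "Pow {..<n} \<times> Pow {..<n}"]) auto
  then have "\<forall>\<^sub>F N in sequentially. \<forall>(I, J) \<in> ?S. 0 < det (submatrix (?X ^\<^sub>m N) I J)"
    using ev by (intro eventually_ball_finite) auto
  then have "\<forall>\<^sub>F N in sequentially. 0 < N \<and> (\<forall>(I, J) \<in> ?S. 0 < det (submatrix (?X ^\<^sub>m N) I J))"
    using eventually_gt_at_top eventually_conj by blast
  then obtain N where "0 < N" "\<forall>(I, J) \<in> ?S. 0 < det (submatrix (?X ^\<^sub>m N) I J)"
    by (auto simp: eventually_sequentially)
  moreover have "dim_row (?X ^\<^sub>m N) = n" "dim_col (?X ^\<^sub>m N) = n"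
    using pow_carrier_mat[of ?X n N] by auto
  ultimately have "totally_positive (?X ^\<^sub>m N)"
    unfolding totally_positive_def by auto
  moreover have "totally_nonnegative ?X"
    using minors_nonneg_shears[OF _ minors_nonneg_one ws]
    by (intro totally_nonnegative_if_minors_nonneg[where n = n]) auto
  ultimately show ?thesis
    using \<open>0 < N\<close> unfolding oscillatory_def by auto
qed

end

section \<open>Bandwidths of products along words\<close>

definition down_word :: "nat list \<Rightarrow> (nat \<times> nat) list" where
  "down_word w = map (\<lambda>x. (Suc x, x)) w"

definition up_word :: "nat list \<Rightarrow> (nat \<times> nat) list" where
  "up_word w = map (\<lambda>x. (x, Suc x)) w"

lemma adjacent_down_up:
  assumes "\<And>x. x \<in> set w \<Longrightarrow> Suc x < n"
  shows "adjacent_word n (down_word w)" "adjacent_word n (up_word w)"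
  using assms by (auto simp: adjacent_word_def down_word_def up_word_def dest: Suc_lessD)

text \<open>Transposition reverses the order of the factors and interchanges lower and upper
  ones.\<close>

lemma rev_swap_down_up:
  "rev (map prod.swap (down_word w)) = up_word (rev w)"
  "rev (map prod.swap (up_word w)) = down_word (rev w)"
  by (simp_all add: down_word_def up_word_def rev_map)

text \<open>The entry at \<open>(r, c)\<close> counts the occurrences of \<open>r - 1, \<dots>, c\<close> as a subsequence of \<open>w\<close>.\<close>

lemma shear_mat_down_entry:
  assumes "\<And>x. x \<in> set w \<Longrightarrow> Suc x < n" "r < n" "c < n"
  shows "0 \<le> shear_mat n 1 (down_word w) $$ (r, c) \<and>
    (shear_mat n 1 (down_word w) $$ (r, c) \<noteq> 0 \<longleftrightarrow> c \<le> r \<and> subseq (rev [c..<r]) w)"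
  using assms
proof (induction w arbitrary: r)
  case Nil
  then show ?case by (auto simp: down_word_def)
next
  case (Cons x w)
  let ?S = "shear_mat n 1 (down_word w)"
  have x: "Suc x < n" using Cons.prems by simp
  have IH: "0 \<le> ?S $$ (s, c)" "?S $$ (s, c) \<noteq> 0 \<longleftrightarrow> c \<le> s \<and> subseq (rev [c..<s]) w" if "s < n" for s
    using Cons.IH[of s] Cons.prems that by auto
  have e: "shear_mat n 1 (down_word (x # w)) $$ (r, c) =
      (if r = Suc x then ?S $$ (x, c) + ?S $$ (r, c) else ?S $$ (r, c))"
    using Cons.prems by (simp add: down_word_def)
  show ?case
  proof (cases "r = Suc x")
    case True
    \<comment> \<open>Both summands are nonnegative, so they cannot cancel.\<close>
    have *: "?S $$ (x, c) + ?S $$ (r, c) \<noteq> 0 \<longleftrightarrow> ?S $$ (x, c) \<noteq> 0 \<or> ?S $$ (r, c) \<noteq> 0"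
      using IH(1)[of x] IH(1)[of r] x Cons.prems(2) by linarith
    show ?thesis
      unfolding e using True * IH[of x] IH[of "Suc x"] x
      by (auto simp: le_Suc_eq dest: subseq_Cons')
  next
    case False
    \<comment> \<open>A nonempty run begins with \<open>r - 1\<close>, which differs from
      \<open>x\<close>, so the new letter cannot be used.\<close>
    have "subseq (rev [c..<r]) (x # w) \<longleftrightarrow> subseq (rev [c..<r]) w" if "c \<le> r"
    proof (cases r)
      case (Suc s)
      then show ?thesis using False that by (cases "c \<le> s") auto
    qed simp
    then show ?thesis unfolding e using False IH[of r] Cons.prems by auto
  qed
qed

text \<open>Mirror image of the descending count: prepending \<open>x\<close> adds row
  \<open>x + 1\<close> to row \<open>x\<close>, which puts \<open>x\<close> in front of the
  ascending runs from \<open>x + 1\<close>.\<close>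

lemma shear_mat_up_entry:
  assumes "\<And>x. x \<in> set w \<Longrightarrow> Suc x < n" "r < n" "c < n"
  shows "0 \<le> shear_mat n 1 (up_word w) $$ (r, c) \<and>
    (shear_mat n 1 (up_word w) $$ (r, c) \<noteq> 0 \<longleftrightarrow> r \<le> c \<and> subseq [r..<c] w)"
  using assms
proof (induction w arbitrary: r)
  case Nil
  then show ?case by (auto simp: up_word_def)
next
  case (Cons x w)
  let ?S = "shear_mat n 1 (up_word w)"
  have x: "Suc x < n" using Cons.prems by simp
  have IH: "0 \<le> ?S $$ (s, c)" "?S $$ (s, c) \<noteq> 0 \<longleftrightarrow> s \<le> c \<and> subseq [s..<c] w" if "s < n" for s
    using Cons.IH[of s] Cons.prems that by auto
  have e: "shear_mat n 1 (up_word (x # w)) $$ (r, c) =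
      (if r = x then ?S $$ (Suc x, c) + ?S $$ (r, c) else ?S $$ (r, c))"
    using Cons.prems by (simp add: up_word_def)
  show ?case
  proof (cases "r = x")
    case True
    have *: "?S $$ (Suc x, c) + ?S $$ (r, c) \<noteq> 0 \<longleftrightarrow> ?S $$ (Suc x, c) \<noteq> 0 \<or> ?S $$ (r, c) \<noteq> 0"
      using IH(1)[of "Suc x"] IH(1)[of r] x Cons.prems(2) by linarith
    show ?thesis
    proof (cases "x < c")
      case True
      then show ?thesis
        unfolding e using \<open>r = x\<close> * IH[of x] IH[of "Suc x"] x
        by (auto simp: upt_conv_Cons dest: subseq_Cons')
    next
      case False
      then show ?thesis
        unfolding e using \<open>r = x\<close> * IH[of x] IH[of "Suc x"] x by auto
    qed
  next
    case False
    then have "subseq [r..<c] (x # w) \<longleftrightarrow> subseq [r..<c] w"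
      by (cases "r < c") (auto simp: upt_conv_Cons)
    then show ?thesis unfolding e using False IH[of r] Cons.prems by auto
  qed
qed

section \<open>Half-bandwidths of matrices and Gram products\<close>

lemma bw_leI:
  assumes "M \<in> carrier_mat n n"
    and "\<And>i j. i < n \<Longrightarrow> j < n \<Longrightarrow> M $$ (i, j) \<noteq> 0 \<Longrightarrow> i \<le> j + b \<and> j \<le> i + b"
  shows "bw M \<le> b"
proof -
  let ?L = "{0} \<union> {i - j | i j. i < dim_row M \<and> j < dim_col M \<and> M $$ (i, j) \<noteq> 0}"
  let ?U = "{0} \<union> {j - i | i j. i < dim_row M \<and> j < dim_col M \<and> M $$ (i, j) \<noteq> 0}"
  have bound: "x \<le> b" if "x \<in> ?L \<union> ?U" for x
    using that assms by fastforce
  then have "finite ?L" "finite ?U"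
    by (meson Un_iff finite_nat_set_iff_bounded_le)+
  then have "bw_minus M \<le> b" "bw_plus M \<le> b"
    unfolding bw_minus_def bw_plus_def using bound by (auto intro!: Max.boundedI)
  then show ?thesis unfolding bw_def by simp
qed

lemma bw_bounds:
  assumes "M \<in> carrier_mat n n" "i < n" "j < n" "M $$ (i, j) \<noteq> 0"
  shows "i - j \<le> bw M" "j - i \<le> bw M"
proof -
  let ?L = "{0} \<union> {i - j | i j. i < dim_row M \<and> j < dim_col M \<and> M $$ (i, j) \<noteq> 0}"
  let ?U = "{0} \<union> {j - i | i j. i < dim_row M \<and> j < dim_col M \<and> M $$ (i, j) \<noteq> 0}"
  have sub: "?L \<subseteq> {..n}" "?U \<subseteq> {..n}" using assms(1) by auto
  have mem: "i - j \<in> ?L" "j - i \<in> ?U" using assms by blast+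
  have "i - j \<le> bw_minus M"
    unfolding bw_minus_def by (rule Max_ge[OF finite_subset[OF sub(1)] mem(1)]) simp
  moreover have "j - i \<le> bw_plus M"
    unfolding bw_plus_def by (rule Max_ge[OF finite_subset[OF sub(2)] mem(2)]) simp
  ultimately show "i - j \<le> bw M" "j - i \<le> bw M" unfolding bw_def by auto
qed

lemma bw_le:
  assumes "M \<in> carrier_mat n n"
  shows "bw M \<le> n - 1"
  using assms by (rule bw_leI) auto

lemma bw_eqI:
  assumes "M \<in> carrier_mat n n"
    and "\<And>i j. i < n \<Longrightarrow> j < n \<Longrightarrow> M $$ (i, j) \<noteq> 0 \<Longrightarrow> i \<le> j + b \<and> j \<le> i + b"
    and "r < n" "c < n" "M $$ (r, c) \<noteq> 0" "r = c + b \<or> c = r + b"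
  shows "bw M = b"
  using bw_leI[OF assms(1,2)] bw_bounds[OF assms(1,3-5)] assms(6) by auto

lemma bw_cong_nonzero:
  assumes "M \<in> carrier_mat n n" "M' \<in> carrier_mat n n"
    and "\<And>i j. i < n \<Longrightarrow> j < n \<Longrightarrow> M $$ (i, j) \<noteq> 0 \<longleftrightarrow> M' $$ (i, j) \<noteq> 0"
  shows "bw M = bw M'"
proof -
  have "{i - j | i j. i < n \<and> j < n \<and> M $$ (i, j) \<noteq> 0} = {i - j | i j. i < n \<and> j < n \<and> M' $$ (i, j) \<noteq> 0}"
    "{j - i | i j. i < n \<and> j < n \<and> M $$ (i, j) \<noteq> 0} = {j - i | i j. i < n \<and> j < n \<and> M' $$ (i, j) \<noteq> 0}"
    using assms(3) by blast+
  then show ?thesis using assms(1,2) unfolding bw_def bw_minus_def bw_plus_def by simp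
qed

text \<open>The entries of the product are sums of nonnegative terms. A nonzero one needs two
  nonzero entries of \<open>T\<close> in a common column, which \<open>band\<close> controls; at
  \<open>(r, c)\<close> the term with the diagonal entry of column \<open>c\<close> is
  positive.\<close>

lemma bw_gram:
  fixes T :: "real mat"
  assumes T: "T \<in> carrier_mat n n"
    and nonneg: "\<And>i j. i < n \<Longrightarrow> j < n \<Longrightarrow> 0 \<le> T $$ (i, j)"
    and diag: "\<And>i. i < n \<Longrightarrow> T $$ (i, i) \<noteq> 0"
    and band: "\<And>i j k. i < n \<Longrightarrow> j < n \<Longrightarrow> k < n \<Longrightarrow> T $$ (i, k) \<noteq> 0 \<Longrightarrow> T $$ (j, k) \<noteq> 0 \<Longrightarrow> i \<le> j + b"
    and rc: "r < n" "c < n" "T $$ (r, c) \<noteq> 0" "r = c + b \<or> c = r + b"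
  shows "bw (T * transpose_mat T) = b"
proof (rule bw_eqI[where n = n])
  have e: "(T * transpose_mat T) $$ (i, j) = (\<Sum>k = 0..<n. T $$ (i, k) * T $$ (j, k))"
    if "i < n" "j < n" for i j
    using T that by (auto simp: scalar_prod_def)
  show "T * transpose_mat T \<in> carrier_mat n n" using T by simp
  show "i \<le> j + b \<and> j \<le> i + b"
    if "i < n" "j < n" "(T * transpose_mat T) $$ (i, j) \<noteq> 0" for i j
  proof -
    obtain k where "k < n" "T $$ (i, k) * T $$ (j, k) \<noteq> 0"
      using \<open>(T * transpose_mat T) $$ (i, j) \<noteq> 0\<close> unfolding e[OF \<open>i < n\<close> \<open>j < n\<close>]
      by (meson atLeastLessThan_iff sum.not_neutral_contains_not_neutral)
    then show ?thesis using band \<open>i < n\<close> \<open>j < n\<close> by auto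
  qed
  have "0 < T $$ (r, c) * T $$ (c, c)"
    using nonneg[OF rc(1,2)] rc(3) nonneg[OF rc(2,2)] diag[OF rc(2)] by (simp add: less_le)
  also have "\<dots> \<le> (T * transpose_mat T) $$ (r, c)"
    unfolding e[OF rc(1,2)]
    by (rule member_le_sum[where i = c and f = "\<lambda>k. T $$ (r, k) * T $$ (c, k)"])
      (use rc nonneg in auto)
  finally show "(T * transpose_mat T) $$ (r, c) \<noteq> 0" by simp
qed (use rc in auto)

section \<open>Words with prescribed run lengths\<close>

lemma set_mono_subseq: "subseq xs ys \<Longrightarrow> set xs \<subseteq> set ys"
  by (auto elim: list_emb_set)

lemma upt_split:
  fixes i j k :: nat
  assumes "i \<le> j" "j \<le> k"
  shows "[i..<k] = [i..<j] @ [j..<k]"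
  using upt_add_eq_append[OF assms(1), of "k - j"] assms(2) by simp

text \<open>The letter \<open>y\<close> can only be found in \<open>v\<close>, and \<open>x\<close>
  would have to follow it there.\<close>

lemma not_subseq_pair:
  assumes "y \<notin> set u" "x \<notin> set v"
  shows "\<not> subseq [y, x] (u @ v)"
proof
  assume "subseq [y, x] (u @ v)"
  then obtain s t where st: "[y, x] = s @ t" "subseq s u" "subseq t v"
    by (auto simp: subseq_append_iff)
  then show False
    using assms subseq_order.trans[of "[y]" s u] subseq_order.trans[of "[x]" t v]
    by (cases s) (auto simp: Cons_eq_append_conv subseq_singleton_left dest: subseq_Cons')
qed

text \<open>Through this, a run is excluded as soon as one of its neighbouring pairs is.\<close>

lemma subseq_upt_pair:
  assumes "c \<le> x" "Suc x < r"
  shows "subseq [x, Suc x] [c..<r]" "subseq [Suc x, x] (rev [c..<r])"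
proof -
  have "[c..<r] = [c..<x] @ [x, Suc x] @ [Suc (Suc x)..<r]"
    using assms upt_split[of c x r] by (simp add: upt_conv_Cons)
  then show "subseq [x, Suc x] [c..<r]" "subseq [Suc x, x] (rev [c..<r])"
    by auto
qed

text \<open>The middle part \<open>0, \<dots>, a - 1, M - 1, \<dots>, a, a, \<dots>, q - 1\<close> with \<open>a = M - p\<close> has a descending run of
  length \<open>p\<close> and an ascending run of length \<open>q\<close>. There are no longer ones, since \<open>x + 1, x\<close> is not a
  subsequence for \<open>x < a\<close>, nor is \<open>x, x + 1\<close> for \<open>q \<le> x + 1 < M\<close>. The letters from \<open>M\<close> on are put
  alternately behind and in front, so that they only create runs of length two.\<close>

lemma word_with_run_lengths:
  fixes m p q :: nat
  assumes pq: "1 \<le> p" "p \<le> m" "1 \<le> q" "q \<le> m" "p + q \<le> m \<longrightarrow> 2 \<le> p \<and> 2 \<le> q"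
  obtains w c r where "set w = {..<m}"
    and "\<And>i j. subseq (rev [i..<j]) w \<Longrightarrow> j \<le> i + p"
    and "\<And>i j. subseq [i..<j] w \<Longrightarrow> j \<le> i + q"
    and "subseq (rev [c..<c + p]) w" "subseq [r..<r + q] w"
proof -
  \<comment> \<open>The descending run fills \<open>[a..<M]\<close> and the ascending one
    \<open>[0..<q]\<close>. The cap \<open>p + q - 1\<close> keeps \<open>a < q\<close>, so together
    they cover all letters below \<open>M\<close>.\<close>
  define M where "M = min m (p + q - 1)"
  define a where "a = M - p"
  have M: "M \<le> m" "a + p = M" "a < q" "q \<le> M" "M < m \<longrightarrow> M + 1 = p + q \<and> 2 \<le> p \<and> 2 \<le> q"
    using pq unfolding M_def a_def by auto
  \<comment> \<open>The letter \<open>M + d\<close> goes in front for odd \<open>d\<close> and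
    behind for even \<open>d\<close>, so neighbours occur in one order only, and this order
    alternates with \<open>d\<close>.\<close>
  define lead where "lead = filter (\<lambda>x. odd (x - M)) [M..<m]"
  define trail where "trail = filter (\<lambda>x. even (x - M)) [M..<m]"
  define w where "w = lead @ [0..<a] @ rev [a..<M] @ [a..<q] @ trail"
  have set_fb: "set lead = {x. M \<le> x \<and> x < m \<and> odd (x - M)}"
    "set trail = {x. M \<le> x \<and> x < m \<and> even (x - M)}"
    unfolding lead_def trail_def by auto
  have set_w: "set w = {..<m}"
    unfolding w_def using M by (auto simp: set_fb)
  \<comment> \<open>The only \<open>x\<close> lies in \<open>[0..<Suc x]\<close>, and
    \<open>Suc x\<close> occurs only after that part.\<close>
  have down_low: "\<not> subseq [Suc x, x] w" if "x < a" for x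
  proof -
    have "w = (lead @ [0..<Suc x]) @ [Suc x..<a] @ rev [a..<M] @ [a..<q] @ trail"
      unfolding w_def using that upt_split[of 0 "Suc x" a] by simp
    then show ?thesis
      using that M not_subseq_pair[of "Suc x" "lead @ [0..<Suc x]" x "[Suc x..<a] @ rev [a..<M] @ [a..<q] @ trail"]
      by (auto simp: set_fb)
  qed
  \<comment> \<open>In both cases \<open>Suc x\<close> can occur only in \<open>trail\<close>, where
    \<open>x\<close> does not occur.\<close>
  have down_high: "\<not> subseq [Suc x, x] w" if "Suc x = M \<or> M \<le> x \<and> odd (x - M)" for x
  proof -
    have "Suc x \<notin> set (lead @ [0..<a] @ rev [a..<M] @ [a..<q])" "x \<notin> set trail"
      using that M(1,3,4) by (auto simp: set_fb Suc_diff_le simp del: even_diff_nat)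
    then show ?thesis
      unfolding w_def using not_subseq_pair[of "Suc x" "lead @ [0..<a] @ rev [a..<M] @ [a..<q]" x trail]
      by simp
  qed
  \<comment> \<open>\<open>Suc x\<close> lies beyond \<open>[a..<q]\<close>, so it occurs only in
    the descending part, ahead of every \<open>x\<close>.\<close>
  have up_mid: "\<not> subseq [x, Suc x] w" if "q \<le> Suc x" "Suc x < M" for x
  proof -
    have "w = (lead @ [0..<a] @ rev [Suc x..<M]) @ rev [a..<Suc x] @ [a..<q] @ trail"
      unfolding w_def using that M upt_split[of a "Suc x" M] by simp
    then show ?thesis
      using that M not_subseq_pair[of x "lead @ [0..<a] @ rev [Suc x..<M]" "Suc x" "rev [a..<Suc x] @ [a..<q] @ trail"]
      by (auto simp: set_fb)
  qed
  have up_high: "\<not> subseq [x, Suc x] w" if "M \<le> x" "even (x - M)" for x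
    using that M not_subseq_pair[of x lead "Suc x" "[0..<a] @ rev [a..<M] @ [a..<q] @ trail"]
    unfolding w_def by (auto simp: set_fb Suc_diff_le)
  have "j \<le> i + p" if sub: "subseq (rev [i..<j]) w" for i j
  proof (rule ccontr)
    assume "\<not> j \<le> i + p"
    then have ij: "i + p < j" by simp
    have pair: "subseq [Suc x, x] w" if "i \<le> x" "Suc x < j" for x
      using subseq_upt_pair(2)[OF that] sub by (rule subseq_order.trans)
    have "j - 1 \<in> set w"
      using set_mono_subseq[OF sub] ij by auto
    then have jm: "j \<le> m" using set_w by auto
    \<comment> \<open>The lowest letter is at least \<open>a\<close>, so the run reaches
      \<open>M\<close>. As it cannot contain both \<open>M\<close> and \<open>M - 1\<close>, all its
      letters are at least \<open>M\<close>, where parity excludes one of any two successive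
      pairs.\<close>
    have "a \<le> i" using pair[of i] down_low[of i] ij pq(1) by fastforce
    then have "M < j" using M(2) ij by linarith
    then have "2 \<le> p" using M(5) jm by linarith
    have "M \<le> i"
      using pair[of "M - 1"] down_high[of "M - 1"] \<open>M < j\<close> M by fastforce
    then show False
      using pair[of i] pair[of "Suc i"] down_high[of i] down_high[of "Suc i"] ij \<open>2 \<le> p\<close>
      by (auto simp: Suc_diff_le)
  qed
  moreover have "j \<le> i + q" if sub: "subseq [i..<j] w" for i j
  proof (rule ccontr)
    assume "\<not> j \<le> i + q"
    then have ij: "i + q < j" by simp
    have pair: "subseq [x, Suc x] w" if "i \<le> x" "Suc x < j" for x
      using subseq_upt_pair(1)[OF that] sub by (rule subseq_order.trans)
    have "j - 1 \<in> set w"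
      using set_mono_subseq[OF sub] ij by auto
    then have jm: "j \<le> m" using set_w by auto
    \<comment> \<open>Otherwise the upper letter of the top pair lies in \<open>[q..<M]\<close>,
      which \<open>up_mid\<close> forbids.\<close>
    have "M < j"
    proof (rule ccontr)
      assume "\<not> M < j"
      then show False using pair[of "j - 2"] up_mid[of "j - 2"] ij pq(3) by fastforce
    qed
    then have big: "M + 1 = p + q" "2 \<le> p" "2 \<le> q" using M(5) jm by linarith+
    \<comment> \<open>Here \<open>p \<ge> 2\<close> gives \<open>q \<le> M - 1\<close>, so
      \<open>up_mid\<close> forbids the pair \<open>M - 2, M - 1\<close>.\<close>
    have "M - 1 \<le> i"
    proof (rule ccontr)
      assume "\<not> M - 1 \<le> i"
      then show False using pair[of "M - 2"] up_mid[of "M - 2"] \<open>M < j\<close> big by fastforce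
    qed
    show False
    \<comment> \<open>A run starting at \<open>M - 1\<close> or \<open>M\<close> is long enough to
      contain \<open>M, M + 1\<close>, but \<open>M\<close> is placed behind and
      \<open>M + 1\<close> in front.\<close>
    proof (cases "i \<le> M")
      case True
      then show False using pair[of M] up_high[of M] \<open>M - 1 \<le> i\<close> ij big by fastforce
    next
      case False
      then show False
        using pair[of i] pair[of "Suc i"] up_high[of i] up_high[of "Suc i"] ij \<open>2 \<le> q\<close>
        by (auto simp: Suc_diff_le)
    qed
  qed
  moreover have "subseq (rev [a..<a + p]) w"
    unfolding w_def M(2) by (intro subseq_drop_many subseq_rev_drop_many subseq_order.refl)
  moreover have "subseq [0..<0 + q] w"
  proof -
    have "[0..<0 + q] = [0..<a] @ [a..<q]"
      using M(3) upt_split[of 0 a q] by simp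
    moreover have "subseq ([] @ [0..<a] @ [] @ [a..<q] @ []) w"
      unfolding w_def by (intro list_emb_append_mono) simp_all
    ultimately show ?thesis by simp
  qed
  ultimately show ?thesis using that set_w by blast
qed

text \<open>The word of \<open>A\<close> is a palindrome up to swapping, which gives symmetry. Read
  backwards with coefficient \<open>- 1\<close> it gives the inverse, which is again a Gram product
  up to signs.\<close>

lemma symmetric_oscillatory_realization:
  fixes n p q :: nat
  assumes "2 \<le> n" "(p, q) \<in> bw_pairs n"
  obtains A B where "A \<in> carrier_mat n n" "symmetric_matrix A" "oscillatory A" "integer_matrix A"
    "det A = 1" "inverse_of_matrix A B" "bw A = p" "bw B = q"
proof -
  \<comment> \<open>The pairs \<open>(1, n - 1)\<close> and \<open>(n - 1, 1)\<close> have sum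
    \<open>n\<close>, so for them the last implication is vacuous.\<close>
  have "1 \<le> p" "p \<le> n - 1" "1 \<le> q" "q \<le> n - 1" "p + q \<le> n - 1 \<longrightarrow> 2 \<le> p \<and> 2 \<le> q"
    using assms unfolding bw_pairs_def by auto
  then obtain w c r where w: "set w = {..<n - 1}"
    and down: "\<And>i j. subseq (rev [i..<j]) w \<Longrightarrow> j \<le> i + p"
    and up: "\<And>i j. subseq [i..<j] w \<Longrightarrow> j \<le> i + q"
    and witness: "subseq (rev [c..<c + p]) w" "subseq [r..<r + q] w"
    by (rule word_with_run_lengths) blast
  have lt: "Suc x < n" if "x \<in> set w" for x using that w by auto
  define ws where "ws = down_word w @ up_word (rev w)"
  let ?L = "shear_mat n 1 (down_word w)" and ?U = "shear_mat n 1 (up_word w)"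
  define A where "A = shear_mat n 1 ws"
  define B where "B = shear_mat n (- 1) (rev ws)"
  have adj: "adjacent_word n ws" "adjacent_word n (down_word w)" "adjacent_word n (up_word w)"
    using adjacent_down_up[of w n] adjacent_down_up[of "rev w" n] lt unfolding ws_def by auto
  have palindrome: "rev (map prod.swap ws) = ws"
    unfolding ws_def using rev_swap_down_up[of w] rev_swap_down_up[of "rev w"] by simp
  have gram_A: "A = ?L * transpose_mat ?L"
    unfolding A_def ws_def using adj by (simp only: shear_mat_append transpose_shear_mat rev_swap_down_up)
  \<comment> \<open>Reversal puts the upper factors first, in the order of \<open>w\<close>, so the
    ascending runs of the same \<open>w\<close> govern the inverse.\<close>
  have rev_ws: "rev ws = up_word w @ down_word (rev w)"
    unfolding ws_def down_word_def up_word_def by (simp add: rev_map)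
  have gram_B: "shear_mat n 1 (rev ws) = ?U * transpose_mat ?U"
    unfolding rev_ws using adj by (simp only: shear_mat_append transpose_shear_mat rev_swap_down_up)
  have L: "0 \<le> ?L $$ (i, j) \<and> (?L $$ (i, j) \<noteq> 0 \<longleftrightarrow> j \<le> i \<and> subseq (rev [j..<i]) w)"
    if "i < n" "j < n" for i j
    using lt that by (intro shear_mat_down_entry) auto
  have U: "0 \<le> ?U $$ (i, j) \<and> (?U $$ (i, j) \<noteq> 0 \<longleftrightarrow> i \<le> j \<and> subseq [i..<j] w)"
    if "i < n" "j < n" for i j
    using lt that by (intro shear_mat_up_entry) auto
  have in_range: "c + p < n" "r + q < n"
  proof -
    have "c + p - 1 \<in> set w" "r + q - 1 \<in> set w"
      using \<open>1 \<le> p\<close> \<open>1 \<le> q\<close> set_mono_subseq[OF witness(1)] set_mono_subseq[OF witness(2)]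
      by auto
    then show "c + p < n" "r + q < n" using w \<open>1 \<le> p\<close> \<open>1 \<le> q\<close> by auto
  qed
  have "bw A = p"
    unfolding gram_A
  proof (rule bw_gram[where r = "c + p" and c = c])
    fix i j k assume "i < n" "j < n" "k < n" "?L $$ (i, k) \<noteq> 0" "?L $$ (j, k) \<noteq> 0"
    then show "i \<le> j + p" using L[of i k] L[of j k] down[of k i] by auto
  qed (use L in_range witness in auto)
  \<comment> \<open>\<open>B\<close> differs from the matrix of the reversed word with coefficient
    \<open>1\<close> by checkerboard signs only.\<close>
  have "bw B = bw (shear_mat n 1 (rev ws))"
    unfolding B_def using adj(1) by (intro bw_cong_nonzero) (auto simp: shear_mat_uminus)
  also have "\<dots> = q"
    unfolding gram_B
  proof (rule bw_gram[where r = r and c = "r + q"])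
    fix i j k assume "i < n" "j < n" "k < n" "?U $$ (i, k) \<noteq> 0" "?U $$ (j, k) \<noteq> 0"
    then show "i \<le> j + q" using U[of i k] U[of j k] up[of j k] by auto
  qed (use U in_range witness in auto)
  finally have "bw B = q" .
  have sym: "transpose_mat A = A"
    unfolding A_def using transpose_shear_mat[OF adj(1)] palindrome by simp
  have "(Suc i, i) \<in> set ws" if "Suc i < n" for i
    using that w unfolding ws_def down_word_def by auto
  then have "oscillatory A"
    using oscillatory_shear_mat[OF adj(1)] sym unfolding A_def by blast
  moreover have "inverse_of_matrix A B"
    using shear_mat_inverse[OF adj(1), of 1] shear_mat_inverse[of n "rev ws" "- 1"] adj(1)
    unfolding inverse_of_matrix_def inverts_mat_def A_def B_def by simp
  ultimately show ?thesis
    using that[of A B] sym det_shear_mat[OF adj(1)] integer_matrix_shear_mat[OF adj(1)]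
      \<open>bw A = p\<close> \<open>bw B = q\<close> unfolding symmetric_matrix_def A_def by simp
qed

section \<open>Tridiagonal matrices and their inverses\<close>

text \<open>Commuting with it expresses block diagonality with a cut after index \<open>t\<close>,
  in a form that passes to powers and inverses.\<close>

definition head_projection :: "nat \<Rightarrow> nat \<Rightarrow> real mat" where
  "head_projection n t = mat n n (\<lambda>(i, j). if i = j \<and> i \<le> t then 1 else 0)"

lemma head_projection_carrier [simp]: "head_projection n t \<in> carrier_mat n n"
  by (simp add: head_projection_def)

lemma head_projection_mult:
  assumes "M \<in> carrier_mat n n" "i < n" "j < n"
  shows "(head_projection n t * M) $$ (i, j) = (if i \<le> t then M $$ (i, j) else 0)"
    and "(M * head_projection n t) $$ (i, j) = (if j \<le> t then M $$ (i, j) else 0)"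
proof -
  have "(head_projection n t * M) $$ (i, j) = (\<Sum>k = 0..<n. (if i = k \<and> i \<le> t then 1 else 0) * M $$ (k, j))"
    using assms by (simp add: head_projection_def scalar_prod_def)
  also have "\<dots> = (\<Sum>k = 0..<n. if k = i then (if i \<le> t then M $$ (i, j) else 0) else 0)"
    by (rule sum.cong) auto
  finally show "(head_projection n t * M) $$ (i, j) = (if i \<le> t then M $$ (i, j) else 0)"
    using assms by simp
  have "(M * head_projection n t) $$ (i, j) = (\<Sum>k = 0..<n. M $$ (i, k) * (if k = j \<and> k \<le> t then 1 else 0))"
    using assms by (simp add: head_projection_def scalar_prod_def)
  also have "\<dots> = (\<Sum>k = 0..<n. if k = j then (if j \<le> t then M $$ (i, j) else 0) else 0)"
    by (rule sum.cong) auto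
  finally show "(M * head_projection n t) $$ (i, j) = (if j \<le> t then M $$ (i, j) else 0)"
    using assms by simp
qed

lemma oscillatory_not_commute_head_projection:
  assumes A: "A \<in> carrier_mat n n" "oscillatory A" and t: "Suc t < n"
  shows "head_projection n t * A \<noteq> A * head_projection n t"
proof
  let ?D = "head_projection n t"
  assume comm: "?D * A = A * ?D"
  have pow: "?D * A ^\<^sub>m k = A ^\<^sub>m k * ?D" for k
  proof (induction k)
    case 0
    then show ?case
      using A right_mult_one_mat[of ?D n n] left_mult_one_mat[of ?D n n] by simp
  next
    case (Suc k)
    have "?D * (A ^\<^sub>m k * A) = (?D * A ^\<^sub>m k) * A"
      using A by (intro assoc_mult_mat[symmetric, of _ n n _ n _ n]) auto
    also have "\<dots> = A ^\<^sub>m k * (?D * A)"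
      unfolding Suc using A by (intro assoc_mult_mat[of _ n n _ n _ n]) auto
    also have "\<dots> = A ^\<^sub>m k * A * ?D"
      unfolding comm using A by (intro assoc_mult_mat[symmetric, of _ n n _ n _ n]) auto
    finally show ?case by simp
  qed
  obtain k where k: "totally_positive (A ^\<^sub>m k)"
    using A(2) unfolding oscillatory_def by blast
  have carr: "A ^\<^sub>m k \<in> carrier_mat n n" using A by simp
  \<comment> \<open>Row \<open>0\<close> belongs to the head and column \<open>n - 1\<close> does
    not, so this corner entry, a minor of order one, vanishes.\<close>
  have "(A ^\<^sub>m k) $$ (0, n - 1) = 0"
    using head_projection_mult[OF carr, of 0 "n - 1" t] pow[of k] t by simp
  moreover have "0 < det (submatrix P {0} {n - 1})"
    if "totally_positive P" "P \<in> carrier_mat n n" for P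
    using that t unfolding totally_positive_def by auto
  from this[OF k carr] have "0 < det (submatrix (A ^\<^sub>m k) {0} {n - 1})" .
  moreover have "det (submatrix (A ^\<^sub>m k) {0} {n - 1}) = minor (A ^\<^sub>m k) 1 (pick {0}) (pick {n - 1})"
    using det_submatrix_eq_minor[OF carr, of "{0}" "{n - 1}"] t by simp
  \<comment> \<open>\<open>pick\<close> of a singleton unfolds to this least element.\<close>
  moreover have "(LEAST a. a = n - Suc 0) = n - Suc 0"
    by (rule Least_equality) simp_all
  ultimately show False
    by (simp add: minor_def det_single)
qed

text \<open>\<open>D A = A B D A = A D B A = A D\<close>.\<close>

lemma inverse_commute:
  fixes A :: "real mat"
  assumes "A \<in> carrier_mat n n" "B \<in> carrier_mat n n" "D \<in> carrier_mat n n"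
    and "A * B = 1\<^sub>m n" "B * A = 1\<^sub>m n" "D * B = B * D"
  shows "D * A = A * D"
proof -
  have "D * A = (A * B) * (D * A)" using assms by simp
  also have "\<dots> = A * (B * (D * A))"
    using assms by (intro assoc_mult_mat[of _ n n _ n _ n]) auto
  also have "B * (D * A) = (B * D) * A"
    using assms by (intro assoc_mult_mat[symmetric, of _ n n _ n _ n]) auto
  also have "\<dots> = D * (B * A)"
    unfolding assms(6)[symmetric] using assms by (intro assoc_mult_mat[of _ n n _ n _ n]) auto
  finally show ?thesis using assms by simp
qed

text \<open>The last column \<open>x\<close> of \<open>N\<close> satisfies \<open>M x = e\<close> with \<open>e\<close> the last unit vector; if its first
  entry vanished, the three-term recurrence given by the rows of \<open>M\<close> would make it vanish entirely.\<close>

lemma tridiagonal_inverse_corner: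
  fixes M N :: "real mat"
  assumes n: "0 < n" and M: "M \<in> carrier_mat n n" and N: "N \<in> carrier_mat n n"
    and MN: "M * N = 1\<^sub>m n" and tri: "bw M \<le> 1"
    and super: "\<And>t. Suc t < n \<Longrightarrow> M $$ (t, Suc t) \<noteq> 0"
  shows "N $$ (0, n - 1) \<noteq> 0"
proof
  assume zero: "N $$ (0, n - 1) = 0"
  have entry: "(\<Sum>k = 0..<n. M $$ (i, k) * N $$ (k, n - 1)) = (if i = n - 1 then 1 else 0)"
    if "i < n" for i
  proof -
    have "(M * N) $$ (i, n - 1) = (\<Sum>k = 0..<n. M $$ (i, k) * N $$ (k, n - 1))"
      using that n M N by (simp add: scalar_prod_def)
    then show ?thesis unfolding MN using that n by simp
  qed
  have "N $$ (i, n - 1) = 0" if "i < n" for i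
    using that
  proof (induction i rule: less_induct)
    case (less i)
    show ?case
    proof (cases i)
      case 0
      then show ?thesis using zero by simp
    next
      case (Suc t)
      \<comment> \<open>In row \<open>t = i - 1\<close> the terms before \<open>i\<close> vanish by
        induction and those after \<open>i\<close> by the bandwidth of \<open>M\<close>.\<close>
      have "(\<Sum>k = 0..<n. M $$ (t, k) * N $$ (k, n - 1)) =
          (\<Sum>k = 0..<n. if k = i then M $$ (t, i) * N $$ (i, n - 1) else 0)"
      proof (rule sum.cong[OF refl])
        fix k assume "k \<in> {0..<n}"
        then have k: "k < n" by simp
        show "M $$ (t, k) * N $$ (k, n - 1) = (if k = i then M $$ (t, i) * N $$ (i, n - 1) else 0)"
        proof (cases "k \<le> i")
          case True
          then show ?thesis using less.IH[of k] k by (cases "k = i") auto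
        next
          case False
          then have "M $$ (t, k) = 0"
            using bw_bounds(2)[OF M, of t k] less.prems Suc k tri by fastforce
          then show ?thesis using False by simp
        qed
      qed
      \<comment> \<open>Row \<open>t\<close> is not the last one, so the right-hand side is
        \<open>0\<close>.\<close>
      then have "M $$ (t, i) * N $$ (i, n - 1) = 0"
        using entry[of t] less.prems Suc by simp
      then show ?thesis using super[of t] less.prems Suc by simp
    qed
  qed
  then show False using entry[of "n - 1"] n by simp
qed

text \<open>By tridiagonality and symmetry, a zero on the superdiagonal would cut \<open>M\<close>
  into two diagonal blocks, contrary to \<open>conn\<close>.\<close>

lemma symmetric_tridiagonal_inverse_bw:
  fixes M N :: "real mat"
  assumes n: "2 \<le> n" and M: "M \<in> carrier_mat n n" and N: "N \<in> carrier_mat n n"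
    and MN: "M * N = 1\<^sub>m n" and sym: "transpose_mat M = M" and tri: "bw M \<le> 1"
    and conn: "\<And>t. Suc t < n \<Longrightarrow> head_projection n t * M \<noteq> M * head_projection n t"
  shows "bw M = 1" "bw N = n - 1"
proof -
  have super: "M $$ (t, Suc t) \<noteq> 0" if t: "Suc t < n" for t
  proof
    assume zero: "M $$ (t, Suc t) = 0"
    have msym: "M $$ (i, j) = M $$ (j, i)" if "i < n" "j < n" for i j
      using that M sym by (metis carrier_matD index_transpose_mat(1))
    have off: "M $$ (i, j) = 0" if "i < n" "j < n" "i \<le> t" "t < j" for i j
    proof (cases "i = t \<and> j = Suc t")
      case True
      then show ?thesis using zero by simp
    next
      case False
      then have "\<not> j - i \<le> 1" using that by auto
      then show ?thesis using bw_bounds(2)[OF M that(1,2)] tri by auto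
    qed
    have "head_projection n t * M = M * head_projection n t"
    proof (rule eq_matI)
      fix i j assume "i < dim_row (M * head_projection n t)" "j < dim_col (M * head_projection n t)"
      then have ij: "i < n" "j < n" using M by (auto simp: head_projection_def)
      show "(head_projection n t * M) $$ (i, j) = (M * head_projection n t) $$ (i, j)"
        using off[of i j] off[of j i] msym[OF ij] ij
        by (simp add: head_projection_mult[OF M ij])
    qed (use M in \<open>auto simp: head_projection_def\<close>)
    then show False using conn[OF t] by simp
  qed
  have "M $$ (0, Suc 0) \<noteq> 0" using super[of 0] n by simp
  then show "bw M = 1" using bw_bounds(2)[OF M, of 0 "Suc 0"] n tri by simp
  have "N $$ (0, n - 1) \<noteq> 0"
    using n by (intro tridiagonal_inverse_corner[OF _ M N MN tri super]) auto
  then have "n - 1 \<le> bw N" using bw_bounds(2)[OF N, of 0 "n - 1"] n by simp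
  then show "bw N = n - 1" using bw_le[OF N] by simp
qed

section \<open>Necessity of the bandwidth pairs\<close>

lemma bw_pairs_necessary:
  assumes n: "2 \<le> n" and A: "A \<in> carrier_mat n n" "symmetric_matrix A" "oscillatory A"
    and inv: "inverse_of_matrix A B"
  shows "(bw A, bw B) \<in> bw_pairs n"
proof -
  have AB: "A * B = 1\<^sub>m n" and BA': "B * A = 1\<^sub>m (dim_row B)"
    using inv A unfolding inverse_of_matrix_def inverts_mat_def by auto
  have "dim_col B = n" using arg_cong[OF AB, of dim_col] by simp
  moreover have "dim_row B = n" using arg_cong[OF BA', of dim_col] A by simp
  ultimately have B: "B \<in> carrier_mat n n" and BA: "B * A = 1\<^sub>m n" using BA' by auto
  have symA: "transpose_mat A = A" using A(2) unfolding symmetric_matrix_def .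
  \<comment> \<open>The transpose of \<open>B\<close> is a left inverse of \<open>A\<close> as well,
    hence equal to \<open>B\<close>.\<close>
  have "transpose_mat B * A = 1\<^sub>m n"
    using arg_cong[OF AB, of transpose_mat] transpose_mult[OF A(1) B] symA by simp
  then have "transpose_mat B = transpose_mat B * (A * B)" "(transpose_mat B * A) * B = B"
    using AB B by simp_all
  then have symB: "transpose_mat B = B"
    using assoc_mult_mat[of "transpose_mat B" n n A n B n] A(1) B by simp
  have connA: "head_projection n t * A \<noteq> A * head_projection n t" if "Suc t < n" for t
    by (rule oscillatory_not_commute_head_projection[OF A(1,3) that])
  then have connB: "head_projection n t * B \<noteq> B * head_projection n t" if "Suc t < n" for t
    using inverse_commute[OF A(1) B head_projection_carrier AB BA] that by blast
  \<comment> \<open>\<open>A\<close> and \<open>B\<close> are interchangeable here, and bandwidth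
    \<open>0\<close> is ruled out along the way.\<close>
  have "bw A \<le> 1 \<Longrightarrow> bw A = 1 \<and> bw B = n - 1"
    using symmetric_tridiagonal_inverse_bw[OF n A(1) B AB symA _ connA] by blast
  moreover have "bw B \<le> 1 \<Longrightarrow> bw B = 1 \<and> bw A = n - 1"
    using symmetric_tridiagonal_inverse_bw[OF n B A(1) BA symB _ connB] by blast
  ultimately consider "bw A = 1" "bw B = n - 1" | "bw B = 1" "bw A = n - 1" | "2 \<le> bw A" "2 \<le> bw B"
    by linarith
  then show ?thesis
    using bw_le[OF A(1)] bw_le[OF B] unfolding bw_pairs_def by cases auto
qed

theorem theorem4p1:
  fixes n :: nat
  assumes "n \<ge> 2"
  shows "(\<forall>p q :: nat.
            (\<exists>A B. A \<in> carrier_mat n n \<and> symmetric_matrix A \<and> oscillatory A \<and>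
                   inverse_of_matrix A B \<and> (bw A, bw B) = (p, q))
            \<longleftrightarrow> (p, q) \<in> bw_pairs n)
       \<and> (\<forall>(p, q) \<in> bw_pairs n.
            \<exists>A B. A \<in> carrier_mat n n \<and> symmetric_matrix A \<and> oscillatory A \<and>
                  integer_matrix A \<and> det A = 1 \<and>
                  inverse_of_matrix A B \<and> (bw A, bw B) = (p, q))"
proof -
  have realize: "\<exists>A B. A \<in> carrier_mat n n \<and> symmetric_matrix A \<and> oscillatory A \<and>
      integer_matrix A \<and> det A = 1 \<and> inverse_of_matrix A B \<and> (bw A, bw B) = (p, q)"
    if "(p, q) \<in> bw_pairs n" for p q
    using symmetric_oscillatory_realization[OF assms that] by (metis prod.inject)
  show ?thesis
  proof (intro conjI allI iffI)
    fix p q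
    assume "\<exists>A B. A \<in> carrier_mat n n \<and> symmetric_matrix A \<and> oscillatory A \<and>
      inverse_of_matrix A B \<and> (bw A, bw B) = (p, q)"
    then show "(p, q) \<in> bw_pairs n" using bw_pairs_necessary[OF assms] by metis
  next
    fix p q assume "(p, q) \<in> bw_pairs n"
    then show "\<exists>A B. A \<in> carrier_mat n n \<and> symmetric_matrix A \<and> oscillatory A \<and>
      inverse_of_matrix A B \<and> (bw A, bw B) = (p, q)"
      using realize by blast
  qed (use realize in auto)
qed

end
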